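(* Let $G$ be an augmented double star on $n$ vertices with $n\ge 12$, and let $\vec G$ be any orientation of $G$. Then $\lceil 2\sqrt n-1\rceil<\operatorname{th}(\vec G)<n$.
   Context: A double star is a tree with exactly two non-leaf vertices $a,b$ (adjacent to each other), each adjacent to at least one leaf. An augmented double star on $n$ vertices is obtained from a double star on $n-1$ vertices with internal vertices $a,b$ by deleting the edge $ab$, adding a new vertex $w$, and adding edges $aw$ and $bw$. An orientation of an undirected graph replaces each edge $\{u,v\}$ by exactly one of $(u,v)$, $(v,u)$. Zero forcing on a digraph: vertices are blue or white; a blue vertex $u$ with exactly one white out-neighbor $w$ may force $w$ ($u\to w$), turning it blue. A set $\mathcal F$ of forces is a set of forces of $B\subseteq V$ if, starting with exactly $B$ blue, the forces in $\mathcal F$ can be validly performed in some order after which no further force is possible. Put $\mathcal F^{[0]}=B$ and $\mathcal F^{[t+1]}=\mathcal F^{[t]}\cup\{w\notin\mathcal F^{[t]}:(u\to w)\in\mathcal F,\ u\in\mathcal F^{[t]},\ w$ the only out-neighbor of $u$ outside $\mathcal F^{[t]}\}$; $\operatorname{pt}(\Gamma;\mathcal F)$ is the least $t$ with $\mathcal F^{[t]}=V$ ($\infty$ if none); $\operatorname{pt}(\Gamma;B)=\min_{\mathcal F}\operatorname{pt}(\Gamma;\mathcal F)$. The throttling number is $\operatorname{th}(\Gamma)=\min_{B\subseteq V}(|B|+\operatorname{pt}(\Gamma;B))$. *)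

theory Defs
  imports Complex_Main "HOL-Library.Extended_Nat" "Graph_Theory.Digraph_Component"
begin

text \<open>
  A finite simple undirected graph is a \<open>pair_graph\<close>: a finite, loop-free digraph whose arc relation
  is symmetric, the edge \<open>{u, v}\<close> being the pair of arcs \<open>(u, v)\<close>, \<open>(v, u)\<close>.

  The library predicate \<open>tree\<close> is not usable for such graphs: every edge would already count as a
  directed cycle \<open>u, v, u\<close> of length two. The cycles of the undirected graph are those of length at
  least three.
\<close>

definition undirected_tree :: "'a pair_pre_digraph \<Rightarrow> bool" where
  "undirected_tree G \<longleftrightarrow>
     pair_graph G \<and> Digraph_Component.connected (with_proj G) \<and>
     \<not> (\<exists>p. pre_digraph.cycle (with_proj G) p \<and> 3 \<le> length p)"

text \<open>In a symmetric digraph the out-degree is the degree of the undirected graph.\<close>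

definition leaf :: "'a pair_pre_digraph \<Rightarrow> 'a \<Rightarrow> bool" where
  "leaf G v \<longleftrightarrow> v \<in> pverts G \<and> out_degree (with_proj G) v = 1"

definition double_star :: "'a pair_pre_digraph \<Rightarrow> 'a \<Rightarrow> 'a \<Rightarrow> bool" where
  "double_star G a b \<longleftrightarrow>
     undirected_tree G \<and> a \<noteq> b \<and> {v \<in> pverts G. \<not> leaf G v} = {a, b} \<and> (a, b) \<in> parcs G \<and>
     (\<exists>x. leaf G x \<and> (a, x) \<in> parcs G) \<and> (\<exists>y. leaf G y \<and> (b, y) \<in> parcs G)"

definition subdivide_edge :: "'a pair_pre_digraph \<Rightarrow> 'a \<Rightarrow> 'a \<Rightarrow> 'a \<Rightarrow> 'a pair_pre_digraph" where
  "subdivide_edge G a b w =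
     \<lparr> pverts = insert w (pverts G),
       parcs = (parcs G - {(a, b), (b, a)}) \<union> {(a, w), (w, a), (b, w), (w, b)} \<rparr>"

definition augmented_double_star :: "'a pair_pre_digraph \<Rightarrow> bool" where
  "augmented_double_star G \<longleftrightarrow>
     (\<exists>S a b w. double_star S a b \<and> w \<notin> pverts S \<and> G = subdivide_edge S a b w)"

definition orientation :: "'a pair_pre_digraph \<Rightarrow> 'a pair_pre_digraph \<Rightarrow> bool" where
  "orientation D G \<longleftrightarrow>
     pverts D = pverts G \<and> parcs D \<subseteq> parcs G \<and>
     (\<forall>(u, v) \<in> parcs G. ((u, v) \<in> parcs D) \<noteq> ((v, u) \<in> parcs D))"

definition out_neighbors :: "'a pair_pre_digraph \<Rightarrow> 'a \<Rightarrow> 'a set" where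
  "out_neighbors D u = {v. (u, v) \<in> parcs D}"

definition can_force :: "'a pair_pre_digraph \<Rightarrow> 'a set \<Rightarrow> 'a \<Rightarrow> 'a \<Rightarrow> bool" where
  "can_force D S u w \<longleftrightarrow> u \<in> S \<and> out_neighbors D u - S = {w}"

fun performable :: "'a pair_pre_digraph \<Rightarrow> 'a set \<Rightarrow> ('a \<times> 'a) list \<Rightarrow> bool" where
  "performable D S [] \<longleftrightarrow> True"
| "performable D S ((u, w) # fs) \<longleftrightarrow> can_force D S u w \<and> performable D (insert w S) fs"

text \<open>The force \<open>u \<rightarrow> w\<close> is the pair \<open>(u, w)\<close>.\<close>

definition set_of_forces :: "'a pair_pre_digraph \<Rightarrow> 'a set \<Rightarrow> ('a \<times> 'a) set \<Rightarrow> bool" where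
  "set_of_forces D B F \<longleftrightarrow>
     (\<exists>fs. set fs = F \<and> performable D B fs \<and> \<not> (\<exists>u w. can_force D (B \<union> snd ` F) u w))"

fun blue_at :: "'a pair_pre_digraph \<Rightarrow> 'a set \<Rightarrow> ('a \<times> 'a) set \<Rightarrow> nat \<Rightarrow> 'a set" where
  "blue_at D B F 0 = B"
| "blue_at D B F (Suc t) =
     blue_at D B F t \<union> {w. \<exists>u. (u, w) \<in> F \<and> can_force D (blue_at D B F t) u w}"

definition pt_forces :: "'a pair_pre_digraph \<Rightarrow> 'a set \<Rightarrow> ('a \<times> 'a) set \<Rightarrow> enat" where
  "pt_forces D B F =
     (if \<exists>t. blue_at D B F t = pverts D then enat (LEAST t. blue_at D B F t = pverts D) else \<infinity>)"

text \<open>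
  The minima below are written as infima in the well-ordered type \<^typ>\<open>enat\<close>, where the infimum of a
  nonempty set is attained. For finite digraphs both index sets are nonempty.
\<close>

definition pt :: "'a pair_pre_digraph \<Rightarrow> 'a set \<Rightarrow> enat" where
  "pt D B = (INF F \<in> {F. set_of_forces D B F}. pt_forces D B F)"

definition throttling_number :: "'a pair_pre_digraph \<Rightarrow> enat" where
  "throttling_number D = (INF B \<in> Pow (pverts D). enat (card B) + pt D B)"

end

theory Submission
  imports Defs
begin

text \<open>
  The two centres \<open>a\<close> and \<open>b\<close> cover all edges, and a vertex performs at most one force, so at most
  four vertices are ever forced and \<open>th \<ge> n - 4\<close>. For the upper bound, the edges joining \<open>a\<close> and
  \<open>b\<close> to one leaf each form an induced matching, so in every orientation their two heads can be
  forced simultaneously by their tails, whence \<open>th \<le> (n - 2) + 1\<close>.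
\<close>

definition vertex_cover :: "'a pair_pre_digraph \<Rightarrow> 'a set \<Rightarrow> bool" where
  "vertex_cover D C \<longleftrightarrow> (\<forall>(u, v) \<in> parcs D. u \<in> C \<or> v \<in> C)"

definition induced_matching :: "'a pair_pre_digraph \<Rightarrow> ('a \<times> 'a) set \<Rightarrow> bool" where
  "induced_matching D M \<longleftrightarrow>
     M \<subseteq> parcs D \<and>
     pairwise (\<lambda>(u, v) (u', v'). {u, v} \<inter> {u', v'} = {} \<and> parcs D \<inter> {u, v} \<times> {u', v'} = {}) M"

lemma induced_matching_arc:
  assumes "induced_matching D M" "(u, v) \<in> M"
  shows "(u, v) \<in> parcs D"
  using assms by (auto simp: induced_matching_def)

lemma
  assumes "induced_matching D M" "(u, v) \<in> M" "(u', v') \<in> M" "(u, v) \<noteq> (u', v')"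
  shows induced_matching_disjoint: "{u, v} \<inter> {u', v'} = {}"
    and induced_matching_nonadjacent: "parcs D \<inter> {u, v} \<times> {u', v'} = {}"
  using assms by (auto simp: induced_matching_def dest: pairwiseD)

lemma performable_arc:
  assumes "performable D S fs" "(u, v) \<in> set fs"
  shows "(u, v) \<in> parcs D"
  using assms
  by (induction D S fs rule: performable.induct) (auto simp: can_force_def out_neighbors_def)

lemma performable_no_force_if_saturated:
  assumes "performable D S fs" "out_neighbors D u \<subseteq> S"
  shows "u \<notin> fst ` set fs"
  using assms
proof (induction D S fs rule: performable.induct)
  case (2 D S u' w fs)
  then show ?case by (auto simp: can_force_def)
qed simp

lemma performable_inj_on_fst:
  assumes "performable D S fs"
  shows "inj_on fst (set fs)"
  using assms
proof (induction D S fs rule: performable.induct)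
  case (2 D S u w fs)
  then have "performable D (insert w S) fs" and "out_neighbors D u \<subseteq> insert w S"
    by (auto simp: can_force_def)
  then have "u \<notin> fst ` set fs" by (rule performable_no_force_if_saturated)
  then show ?case using 2 by auto
qed simp

lemma performable_if_distinct_heads:
  assumes "\<And>u w. (u, w) \<in> set fs \<Longrightarrow> can_force D S u w" "distinct (map snd fs)"
  shows "performable D S fs"
  using assms
proof (induction D S fs rule: performable.induct)
  case (2 D S u w fs)
  have "can_force D (insert w S) u' w'" if "(u', w') \<in> set fs" for u' w'
  proof -
    have "can_force D S u' w'" using that by (intro "2.prems"(1)) simp
    moreover have "w' \<noteq> w" using that "2.prems"(2) by force
    ultimately show ?thesis by (auto simp: can_force_def)
  qed
  then show ?case using 2 by simp
qed simp

lemma blue_at_subset: "blue_at D B F t \<subseteq> B \<union> snd ` F"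
  by (induction t) (auto simp: image_iff, force)

lemma pt_le:
  assumes "set_of_forces D B F" "blue_at D B F t = pverts D"
  shows "pt D B \<le> enat t"
proof -
  have "pt D B \<le> pt_forces D B F"
    unfolding pt_def by (rule INF_lower) (simp add: assms(1))
  also have "\<dots> \<le> enat t"
    using assms(2) by (auto simp: pt_forces_def intro: Least_le)
  finally show ?thesis .
qed

lemma pt_finiteE:
  assumes "pt D B \<noteq> \<infinity>"
  obtains fs where "performable D B fs" "pverts D \<subseteq> B \<union> snd ` set fs"
proof -
  obtain F where F: "set_of_forces D B F" and "pt_forces D B F \<noteq> \<infinity>"
    using assms unfolding pt_def by (metis INF_top_conv(2) mem_Collect_eq top_enat_def)
  then obtain t where "blue_at D B F t = pverts D"
    by (auto simp: pt_forces_def split: if_splits)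
  then show thesis
    using that F blue_at_subset[of D B F t] by (auto simp: set_of_forces_def)
qed

lemma card_forced_le_vertex_cover:
  assumes "vertex_cover D C" "finite C" "performable D B fs"
  shows "card (snd ` set fs) \<le> 2 * card C"
proof -
  let ?F = "{f \<in> set fs. fst f \<in> C}"
  have "inj_on fst ?F"
    using performable_inj_on_fst[OF assms(3)] by (rule inj_on_subset) simp
  then have "card ?F \<le> card C"
    using \<open>finite C\<close> by (intro card_inj_on_le) auto
  then have "card (snd ` ?F) \<le> card C"
    using card_image_le[of ?F snd] by simp
  moreover have "snd ` set fs \<subseteq> C \<union> snd ` ?F"
    using assms(1) performable_arc[OF assms(3)] by (fastforce simp: vertex_cover_def)
  then have "card (snd ` set fs) \<le> card (C \<union> snd ` ?F)"
    using \<open>finite C\<close> by (intro card_mono) auto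
  ultimately show ?thesis
    using card_Un_le[of C "snd ` ?F"] by linarith
qed

lemma throttling_number_ge_vertex_cover:
  assumes "vertex_cover D C" "finite C" "finite (pverts D)"
  shows "enat (card (pverts D) - 2 * card C) \<le> throttling_number D"
  unfolding throttling_number_def
proof (rule INF_greatest)
  fix B assume "B \<in> Pow (pverts D)"
  then have "finite B" using assms(3) finite_subset by blast
  show "enat (card (pverts D) - 2 * card C) \<le> enat (card B) + pt D B"
  proof (cases "pt D B = \<infinity>")
    case False
    then obtain fs where "performable D B fs" and "pverts D \<subseteq> B \<union> snd ` set fs"
      by (rule pt_finiteE)
    then have "card (pverts D) \<le> card (B \<union> snd ` set fs)"
      using \<open>finite B\<close> by (intro card_mono) auto
    also have "\<dots> \<le> card B + 2 * card C"
      using card_Un_le[of B "snd ` set fs"]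
        card_forced_le_vertex_cover[OF assms(1,2) \<open>performable D B fs\<close>] by linarith
    finally have "enat (card (pverts D) - 2 * card C) \<le> enat (card B)" by simp
    then show ?thesis by (meson add_increasing2 zero_le)
  qed simp
qed

lemma (in pair_fin_digraph) pt_le_1:
  assumes "B \<subseteq> pverts G" and "\<And>w. w \<in> pverts G - B \<Longrightarrow> \<exists>u. can_force G B u w"
  shows "pt G B \<le> 1"
proof -
  obtain f where f: "can_force G B (f w) w" if "w \<in> pverts G - B" for w
    using assms(2) by metis
  obtain ws where ws: "set ws = pverts G - B" "distinct ws"
    using finite_distinct_list[OF finite_Diff[OF pair_finite_verts]] by metis
  define fs where "fs = map (\<lambda>w. (f w, w)) ws"
  have forced: "B \<union> snd ` set fs = pverts G"
    using assms(1) ws(1) by (auto simp: fs_def image_image)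
  have "performable G B fs"
    using f ws by (intro performable_if_distinct_heads) (auto simp: fs_def comp_def)
  moreover have "\<not> can_force G (pverts G) u w" for u w
    by (auto simp: can_force_def out_neighbors_def dest: in_arcsD2)
  ultimately have "set_of_forces G B (set fs)"
    unfolding set_of_forces_def forced by blast
  moreover have "blue_at G B (set fs) 1 = pverts G"
    using assms(1) f ws by (auto simp: fs_def)
  ultimately show ?thesis
    using pt_le[of G B "set fs" 1] by (simp add: one_enat_def)
qed

lemma (in pair_digraph) induced_matching_can_force:
  assumes M: "induced_matching G M" and uw: "(u, w) \<in> M"
  shows "can_force G (pverts G - snd ` M) u w"
proof -
  have arc: "(u, w) \<in> parcs G" using M uw by (rule induced_matching_arc)
  have not_head: "v \<noteq> u" and only_head: "(u, v) \<in> parcs G \<Longrightarrow> v = w" if "(u', v) \<in> M" for u' v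
    using induced_matching_disjoint[OF M uw that] induced_matching_nonadjacent[OF M uw that]
      no_loops'[OF arc] by auto
  have "u \<in> pverts G - snd ` M"
    using not_head in_arcsD1[OF arc] by fastforce
  moreover have "out_neighbors G u - (pverts G - snd ` M) = {w}"
  proof
    show "out_neighbors G u - (pverts G - snd ` M) \<subseteq> {w}"
      using only_head by (auto simp: out_neighbors_def dest: in_arcsD2)
    show "{w} \<subseteq> out_neighbors G u - (pverts G - snd ` M)"
      using arc uw by (force simp: out_neighbors_def)
  qed
  ultimately show ?thesis by (simp add: can_force_def)
qed

lemma (in pair_digraph) throttling_number_le_induced_matching:
  assumes M: "induced_matching G M"
  shows "throttling_number G \<le> enat (card (pverts G) - card M + 1)"
proof -
  define B where "B = pverts G - snd ` M"
  have heads: "snd ` M \<subseteq> pverts G"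
    using in_arcsD2[OF induced_matching_arc[OF M]] by auto
  have "inj_on snd M"
    using induced_matching_disjoint[OF M] by (fastforce simp: inj_on_def)
  then have "card (snd ` M) = card M" by (rule card_image)
  then have card_B: "card B = card (pverts G) - card M"
    using card_Diff_subset[OF finite_subset[OF heads pair_finite_verts] heads] by (simp add: B_def)
  have "\<exists>u. can_force G B u w" if "w \<in> pverts G - B" for w
    using that induced_matching_can_force[OF M] unfolding B_def by fastforce
  then have "pt G B \<le> 1" by (intro pt_le_1) (auto simp: B_def)
  have "throttling_number G \<le> enat (card B) + pt G B"
    unfolding throttling_number_def by (rule INF_lower) (simp add: B_def)
  also have "\<dots> \<le> enat (card B) + 1"
    using \<open>pt G B \<le> 1\<close> by (rule add_left_mono)
  finally show ?thesis by (simp add: card_B one_enat_def)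
qed

lemma orientation_pair_digraph:
  assumes "orientation D G" "pair_digraph G"
  shows "pair_digraph D"
proof -
  interpret pair_digraph G by fact
  have verts: "pverts D = pverts G" and arcs: "parcs D \<subseteq> parcs G"
    using assms(1) by (auto simp: orientation_def)
  show ?thesis
    using verts pair_finite_verts finite_subset[OF arcs pair_finite_arcs] subsetD[OF arcs]
    by unfold_locales (auto simp: pair_no_loops intro: arc_fst_in_verts arc_snd_in_verts)
qed

lemma orientation_vertex_cover:
  assumes "orientation D G" "vertex_cover G C"
  shows "vertex_cover D C"
  using assms by (auto simp: orientation_def vertex_cover_def)

lemma orientation_induced_matching:
  assumes D: "orientation D G" and M: "induced_matching G M"
  obtains M' where "induced_matching D M'" "card M' = card M"
proof
  define orient where "orient = (\<lambda>e. if e \<in> parcs D then e else prod.swap e)"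
  have ends: "{fst (orient e), snd (orient e)} = {fst e, snd e}" for e
    by (auto simp: orient_def)
  have disjoint: "{fst e, snd e} \<inter> {fst e', snd e'} = {}"
    and nonadjacent: "parcs G \<inter> {fst e, snd e} \<times> {fst e', snd e'} = {}"
    if "e \<in> M" "e' \<in> M" "e \<noteq> e'" for e e'
    using induced_matching_disjoint[OF M, of "fst e" "snd e" "fst e'" "snd e'"]
      induced_matching_nonadjacent[OF M, of "fst e" "snd e" "fst e'" "snd e'"] that by auto
  have "inj_on orient M"
    using disjoint ends by (intro inj_onI) (metis Int_absorb insert_not_empty)
  then show "card (orient ` M) = card M" by (rule card_image)
  have "orient ` M \<subseteq> parcs D"
    using D M by (force simp: orientation_def induced_matching_def orient_def)
  moreover have "parcs D \<subseteq> parcs G"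
    using D by (simp add: orientation_def)
  ultimately show "induced_matching D (orient ` M)"
    unfolding induced_matching_def pairwise_image case_prod_beta ends
    using disjoint nonadjacent by (intro conjI pairwiseI impI; blast)
qed

lemma leaf_neighbor_unique:
  assumes "leaf G x" "(x, u) \<in> parcs G" "(x, v) \<in> parcs G"
  shows "u = v"
proof -
  have "card (out_arcs (with_proj G) x) = 1"
    using assms(1) by (simp add: leaf_def out_degree_def)
  then obtain e where e: "out_arcs (with_proj G) x = {e}" by (rule card_1_singletonE)
  have "(x, u) \<in> out_arcs (with_proj G) x" "(x, v) \<in> out_arcs (with_proj G) x"
    using assms(2,3) by simp_all
  then show ?thesis unfolding e by auto
qed

lemma (in pair_sym_digraph) connected_subset_if_closed:
  assumes "Digraph_Component.connected (with_proj G)"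
    and "\<And>u v. u \<in> X \<Longrightarrow> (u, v) \<in> parcs G \<Longrightarrow> v \<in> X"
    and "x \<in> X" "x \<in> pverts G"
  shows "pverts G \<subseteq> X"
proof
  fix y assume "y \<in> pverts G"
  then have "x \<rightarrow>\<^sup>*\<^bsub>with_proj G\<^esub> y"
    using symmetric_connected_imp_strongly_connected[OF pair_sym_arcs assms(1)] assms(4)
    by (simp add: strongly_connected_def)
  then show "y \<in> X"
    by (induction rule: reachable_induct) (use assms in auto)
qed

lemma (in pair_sym_digraph) connected_vertex_cover_non_leaves:
  assumes conn: "Digraph_Component.connected (with_proj G)"
    and "z \<in> pverts G" "\<not> leaf G z"
  shows "vertex_cover G {v \<in> pverts G. \<not> leaf G v}"
proof -
  have False if arc: "(u, v) \<in> parcs G" and leaves: "leaf G u" "leaf G v" for u v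
  proof -
    have "pverts G \<subseteq> {u, v}"
    proof (rule connected_subset_if_closed[OF conn])
      show "y \<in> {u, v}" if "x \<in> {u, v}" "(x, y) \<in> parcs G" for x y
        using that leaf_neighbor_unique[OF leaves(1) arc, of y]
          leaf_neighbor_unique[OF leaves(2) arcs_symmetric[OF arc], of y] by auto
    qed (use in_arcsD1[OF arc] in auto)
    then show False using assms(2,3) leaves by auto
  qed
  then show ?thesis
    unfolding vertex_cover_def by (auto dest: in_arcsD1 in_arcsD2)
qed

lemma subdivide_edge_eq_subdivide: "subdivide_edge G a b w = subdivide G (a, b) w"
  by (auto simp: subdivide_edge_def subdivide.simps)

lemma vertex_cover_subdivide:
  assumes "vertex_cover G C" "a \<in> C" "b \<in> C"
  shows "vertex_cover (subdivide G (a, b) w) C"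
  using assms by (auto simp: vertex_cover_def)

lemma (in pair_graph) induced_matching_subdivide:
  assumes "(a, b) \<in> parcs G" "w \<notin> pverts G"
    and x: "leaf G x" "(a, x) \<in> parcs G" "x \<noteq> b"
    and y: "leaf G y" "(b, y) \<in> parcs G" "y \<noteq> a"
  shows "induced_matching (subdivide G (a, b) w) {(a, x), (b, y)}"
proof -
  have nbr_x: "u = a" if "(x, u) \<in> parcs G \<or> (u, x) \<in> parcs G" for u
    using that leaf_neighbor_unique[OF x(1)] arcs_symmetric x(2) by blast
  have nbr_y: "u = b" if "(y, u) \<in> parcs G \<or> (u, y) \<in> parcs G" for u
    using that leaf_neighbor_unique[OF y(1)] arcs_symmetric y(2) by blast
  have "a \<noteq> b" "a \<noteq> x" "b \<noteq> y"
    using assms no_loops' by blast+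
  moreover have "x \<noteq> y" using nbr_y x(2) \<open>a \<noteq> b\<close> by blast
  moreover have "w \<notin> {a, b, x, y}"
    using assms by (auto dest: in_arcsD1 in_arcsD2)
  moreover have "(a, y) \<notin> parcs G" "(y, a) \<notin> parcs G" "(b, x) \<notin> parcs G" "(x, b) \<notin> parcs G"
    "(x, y) \<notin> parcs G" "(y, x) \<notin> parcs G"
    using nbr_x nbr_y \<open>a \<noteq> b\<close> x(3) y(3) by blast+
  ultimately show ?thesis
    using x y by (auto simp: induced_matching_def pairwise_insert)
qed

lemma augmented_double_starE:
  assumes "augmented_double_star G"
  obtains C M where "pair_graph G"
    and "vertex_cover G C" "card C = 2"
    and "induced_matching G M" "card M = 2"
proof -
  obtain S a b w where ds: "double_star S a b" and w: "w \<notin> pverts S"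
    and G: "G = subdivide S (a, b) w"
    using assms unfolding augmented_double_star_def subdivide_edge_eq_subdivide by blast
  have graph: "pair_graph S" and conn: "Digraph_Component.connected (with_proj S)"
    and "a \<noteq> b" and centres: "{v \<in> pverts S. \<not> leaf S v} = {a, b}" and ab: "(a, b) \<in> parcs S"
    using ds unfolding double_star_def undirected_tree_def by blast+
  interpret pair_graph S by (rule graph)
  obtain x y where x: "leaf S x" "(a, x) \<in> parcs S" and y: "leaf S y" "(b, y) \<in> parcs S"
    using ds unfolding double_star_def by blast
  have centre: "a \<in> pverts S" "\<not> leaf S a" "\<not> leaf S b" using centres by blast+
  show thesis
  proof
    show "pair_graph G"
      unfolding G using ab w by (rule pair_graph_subdivide)
    have "vertex_cover S {a, b}"
      using connected_vertex_cover_non_leaves[OF conn centre(1,2)] by (simp only: centres)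
    then show "vertex_cover G {a, b}"
      unfolding G by (rule vertex_cover_subdivide) simp_all
    show "induced_matching G {(a, x), (b, y)}"
      unfolding G using ab w x y centre by (intro induced_matching_subdivide) auto
  qed (use \<open>a \<noteq> b\<close> in auto)
qed

lemma ceiling_two_sqrt_less:
  assumes "12 \<le> n"
  shows "nat \<lceil>2 * sqrt (real n) - 1\<rceil> < n - 4"
proof -
  have "12 * real n \<le> real n * real n"
    using assms by (intro mult_right_mono) auto
  then have "4 * real n \<le> (real n - 4)\<^sup>2"
    by (simp add: power2_eq_square algebra_simps)
  then have "sqrt (4 * real n) \<le> real n - 4"
    using assms by (intro real_le_lsqrt) auto
  then have "2 * sqrt (real n) - 1 \<le> of_int (int n - 5)"
    by (simp add: real_sqrt_mult)
  then have "\<lceil>2 * sqrt (real n) - 1\<rceil> \<le> int n - 5" by (rule ceiling_le)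
  then show ?thesis using assms by linarith
qed

theorem theorem3p12:
  fixes G D :: "'a pair_pre_digraph" and n :: nat
  assumes "augmented_double_star G"
    and "card (pverts G) = n"
    and "n \<ge> 12"
    and "orientation D G"
  shows "enat (nat \<lceil>2 * sqrt (real n) - 1\<rceil>) < throttling_number D \<and> throttling_number D < enat n"
proof
  obtain C M where "pair_graph G" and C: "vertex_cover G C" "card C = 2"
    and "induced_matching G M" "card M = 2"
    using assms(1) by (rule augmented_double_starE)
  then obtain M' where M': "induced_matching D M'" "card M' = 2"
    using assms(4) by (metis orientation_induced_matching)
  interpret D: pair_digraph D
    using assms(4) pair_graph.axioms(1)[OF \<open>pair_graph G\<close>] by (rule orientation_pair_digraph)
  have n: "card (pverts D) = n" using assms(2,4) by (simp add: orientation_def)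
  have "finite C" using C(2) by (simp add: card_ge_0_finite)
  have "enat (nat \<lceil>2 * sqrt (real n) - 1\<rceil>) < enat (n - 4)"
    using ceiling_two_sqrt_less[OF assms(3)] by simp
  also have "enat (n - 4) \<le> throttling_number D"
    using throttling_number_ge_vertex_cover[OF orientation_vertex_cover[OF assms(4) C(1)]
        \<open>finite C\<close> D.pair_finite_verts] C(2) n by simp
  finally show "enat (nat \<lceil>2 * sqrt (real n) - 1\<rceil>) < throttling_number D" .
  have "throttling_number D \<le> enat (n - 2 + 1)"
    using D.throttling_number_le_induced_matching[OF M'(1)] M'(2) n by simp
  also have "\<dots> < enat n" using assms(3) by simp
  finally show "throttling_number D < enat n" .
qed

end
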